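(* There exists an absolute constant $c>0$ such that for all integers $k \geq 1$ and $n \geq 3$, every $k$-degenerate graph $G$ on $n$ vertices satisfies $\pi(G) \leq c\, k \log\log n$. (That is, $\pi(G) \in O(k \log\log n)$ for $k$-degenerate graphs $G$ on $n$ vertices.)
   Context: All graphs are finite, simple and undirected; $\log$ denotes the logarithm to base $2$. A permutation of a finite set $U$ is a bijection $\sigma: U \to [|U|]$. For disjoint $A,B \subseteq U$, write $A \prec_\sigma B$ if $\sigma(a)<\sigma(b)$ for all $a \in A$, $b \in B$; $\sigma$ separates $A$ and $B$ if $A \prec_\sigma B$ or $B \prec_\sigma A$. A family $\mathcal{F}$ of permutations of $V(G)$ is pairwise suitable for $G$ if for every two disjoint edges $e,f$ of $G$ (viewed as 2-element vertex sets) some $\sigma \in \mathcal{F}$ separates $e$ and $f$. The separation dimension $\pi(G)$ is the minimum cardinality of a family of permutations of $V(G)$ that is pairwise suitable for $G$. For a non-negative integer $k$, a graph $G$ is $k$-degenerate if its vertices can be enumerated so that every vertex is succeeded in the enumeration by at most $k$ of its neighbours. *)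

theory Defs
  imports Complex_Main "HOL-Library.FuncSet"
begin

definition simple_graph :: "'a set \<Rightarrow> 'a set set \<Rightarrow> bool" where
  "simple_graph V E \<longleftrightarrow> finite V \<and> (\<forall>e\<in>E. e \<subseteq> V \<and> card e = 2)"

text \<open>
  Permutations are total functions in HOL; requiring the value \<open>undefined\<close> outside \<open>U\<close> makes
  them correspond one-to-one to the bijections from \<open>U\<close> to \<open>{1..card U}\<close>, so that cardinalities
  of sets of permutations are the intended ones.
\<close>
definition permutations_of :: "'a set \<Rightarrow> ('a \<Rightarrow> nat) set" where
  "permutations_of U = {\<sigma> \<in> extensional U. bij_betw \<sigma> U {1..card U}}"

definition precedes :: "('a \<Rightarrow> nat) \<Rightarrow> 'a set \<Rightarrow> 'a set \<Rightarrow> bool" where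
  "precedes \<sigma> A B \<longleftrightarrow> (\<forall>a\<in>A. \<forall>b\<in>B. \<sigma> a < \<sigma> b)"

definition separates :: "('a \<Rightarrow> nat) \<Rightarrow> 'a set \<Rightarrow> 'a set \<Rightarrow> bool" where
  "separates \<sigma> A B \<longleftrightarrow> precedes \<sigma> A B \<or> precedes \<sigma> B A"

definition pairwise_suitable :: "'a set \<Rightarrow> 'a set set \<Rightarrow> ('a \<Rightarrow> nat) set \<Rightarrow> bool" where
  "pairwise_suitable V E F \<longleftrightarrow>
     F \<subseteq> permutations_of V \<and>
     (\<forall>e\<in>E. \<forall>f\<in>E. e \<inter> f = {} \<longrightarrow> (\<exists>\<sigma>\<in>F. separates \<sigma> e f))"

definition separation_dimension :: "'a set \<Rightarrow> 'a set set \<Rightarrow> nat" where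
  "separation_dimension V E = (LEAST d. \<exists>F. pairwise_suitable V E F \<and> card F = d)"

definition degenerate :: "nat \<Rightarrow> 'a set \<Rightarrow> 'a set set \<Rightarrow> bool" where
  "degenerate k V E \<longleftrightarrow>
     (\<exists>\<sigma>\<in>permutations_of V. \<forall>v\<in>V. card {w \<in> V. {v, w} \<in> E \<and> \<sigma> v < \<sigma> w} \<le> k)"

text \<open>
  For a finite graph the minimum defining the separation dimension ranges over a nonempty set
  of finite families.
\<close>

lemma finite_permutations_of:
  assumes "finite U"
  shows "finite (permutations_of U)"
proof (rule finite_subset)
  show "permutations_of U \<subseteq> U \<rightarrow>\<^sub>E {1..card U}"
    by (auto simp: permutations_of_def PiE_def bij_betw_def)
  show "finite (U \<rightarrow>\<^sub>E {1..card U})"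
    using assms by (simp add: finite_PiE)
qed

lemma ex_permutation_precedes:
  assumes "finite U" and "A \<subseteq> U" and "B \<subseteq> U" and "A \<inter> B = {}"
  shows "\<exists>\<sigma>\<in>permutations_of U. precedes \<sigma> A B"
proof -
  have fin: "finite A" "finite (U - A)"
    using assms by (auto intro: finite_subset)
  obtain g where g: "bij_betw g A {1..card A}"
    using ex_bij_betw_finite_nat[OF fin(1)] fin(1)
    by (metis bij_betw_iff_card card_atLeastAtMost diff_Suc_1 finite_atLeastAtMost)
  have cU: "card U = card A + card (U - A)"
    using assms by (metis card_Diff_subset card_mono fin(1) le_add_diff_inverse)
  obtain h where h: "bij_betw h (U - A) {Suc (card A)..card U}"
    using bij_betw_iff_card[OF fin(2), of "{Suc (card A)..card U}"] cU by auto
  define \<sigma> where "\<sigma> = restrict (\<lambda>x. if x \<in> A then g x else h x) U"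
  have 1: "bij_betw \<sigma> A {1..card A}"
    using g assms(2) by (subst bij_betw_cong[where g = g]) (auto simp: \<sigma>_def)
  have 2: "bij_betw \<sigma> (U - A) {Suc (card A)..card U}"
    using h by (subst bij_betw_cong[where g = h]) (auto simp: \<sigma>_def)
  have "bij_betw \<sigma> (A \<union> (U - A)) ({1..card A} \<union> {Suc (card A)..card U})"
    by (rule bij_betw_combine[OF 1 2]) auto
  moreover have "A \<union> (U - A) = U" "{1..card A} \<union> {Suc (card A)..card U} = {1..card U}"
    using assms(2) cU by auto
  ultimately have "\<sigma> \<in> permutations_of U"
    by (simp add: permutations_of_def \<sigma>_def)
  moreover have "precedes \<sigma> A B"
    unfolding precedes_def
  proof (intro ballI)
    fix a b assume "a \<in> A" "b \<in> B"
    with assms have "b \<in> U - A" by auto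
    with \<open>a \<in> A\<close> have "\<sigma> a \<in> {1..card A}" "\<sigma> b \<in> {Suc (card A)..card U}"
      using 1 2 by (simp_all only: bij_betwE)
    then show "\<sigma> a < \<sigma> b" by auto
  qed
  ultimately show ?thesis by blast
qed

lemma pairwise_suitable_permutations_of:
  assumes "simple_graph V E"
  shows "pairwise_suitable V E (permutations_of V)"
  unfolding pairwise_suitable_def separates_def
  using assms ex_permutation_precedes[of V] by (simp add: simple_graph_def) metis

end

(*
  Directing each edge towards its later end and numbering the at most k edges leaving each vertex
  splits G into k functional forests, and the parity of the depth splits each of these into two
  star forests. Suppose a family F of linear orders of V puts any vertex a before any two other
  vertices b, c in one of its orders. Listing the stars as blocks, each with its centre first, and
  ordering both the blocks and the leaves by an order of F (the blocks also by its reverse) separates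
  every edge of the star forest from every pair disjoint from it. So the separation dimension is
  at most 4 k |F|.

  Such a family on N * N points arises from one on N points by lexicographic products: the products
  of each order with itself handle points that agree or disagree in the first coordinate alike, and
  four more orders handle the mixed case. Squaring s times from two points gives 4 s + 2 orders on
  2^(2^s) points, and s is about log log n.
*)
theory Submission
  imports Defs "HOL-Library.Product_Lexorder"
begin

section \<open>Permutations from injective sort keys\<close>

text \<open>Sorting \<open>V\<close> by a key turns every order used below into a permutation;
  \<open>restrict\<close> supplies the value outside \<open>V\<close> that
  \<open>permutations_of\<close> demands.\<close>

definition rank :: "'a set \<Rightarrow> ('a \<Rightarrow> 'b::linorder) \<Rightarrow> 'a \<Rightarrow> nat" where
  "rank V f = restrict (\<lambda>x. card {y \<in> V. f y \<le> f x}) V"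

lemma rank_less:
  assumes "finite V" "x \<in> V" "y \<in> V" "f x < f y"
  shows "rank V f x < rank V f y"
proof -
  have "{z \<in> V. f z \<le> f x} \<subseteq> {z \<in> V. f z \<le> f y}"
    using assms by auto
  moreover have "y \<in> {z \<in> V. f z \<le> f y} - {z \<in> V. f z \<le> f x}"
    using assms by auto
  ultimately have "{z \<in> V. f z \<le> f x} \<subset> {z \<in> V. f z \<le> f y}"
    by blast
  then show ?thesis
    using assms by (simp add: rank_def psubset_card_mono)
qed

lemma inj_on_rank:
  assumes "finite V" "inj_on f V"
  shows "inj_on (rank V f) V"
  by (rule inj_onI) (metis assms inj_onD linorder_less_linear order_less_irrefl rank_less)

lemma rank_in_permutations_of:
  assumes "finite V" "inj_on f V"
  shows "rank V f \<in> permutations_of V"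
proof -
  have "rank V f ` V \<subseteq> {1..card V}"
  proof (rule image_subsetI)
    fix x assume x: "x \<in> V"
    then have "{y \<in> V. f y \<le> f x} \<noteq> {}" by auto
    then show "rank V f x \<in> {1..card V}"
      using x assms(1) by (auto simp: rank_def Suc_le_eq card_gt_0_iff intro: card_mono)
  qed
  then have "bij_betw (rank V f) V {1..card V}"
    using inj_on_rank[OF assms]
    by (metis bij_betw_def card_atLeastAtMost card_image card_subset_eq diff_Suc_1 finite_atLeastAtMost)
  then show ?thesis
    by (simp add: permutations_of_def rank_def)
qed

subsection \<open>Families of orders suitable for triples\<close>

text \<open>Orders are integer keys rather than permutations, so that negation reverses an order.
  Allowing \<open>b = c\<close> makes the condition cover single comparisons too.\<close>

definition triple_suitable :: "'a set \<Rightarrow> ('a \<Rightarrow> int) set \<Rightarrow> bool" where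
  "triple_suitable A F \<longleftrightarrow> finite F \<and> (\<forall>\<sigma>\<in>F. inj_on \<sigma> A) \<and>
     (\<forall>a\<in>A. \<forall>b\<in>A. \<forall>c\<in>A. a \<noteq> b \<longrightarrow> a \<noteq> c \<longrightarrow> (\<exists>\<sigma>\<in>F. \<sigma> a < \<sigma> b \<and> \<sigma> a < \<sigma> c))"

lemma triple_suitableD:
  assumes "triple_suitable A F" "a \<in> A" "b \<in> A" "c \<in> A" "a \<noteq> b" "a \<noteq> c"
  shows "\<exists>\<sigma>\<in>F. \<sigma> a < \<sigma> b \<and> \<sigma> a < \<sigma> c"
  using assms unfolding triple_suitable_def by blast

lemma triple_suitable_comp:
  assumes F: "triple_suitable B F" and g: "inj_on g A" "g ` A \<subseteq> B"
  shows "triple_suitable A ((\<lambda>\<sigma>. \<sigma> \<circ> g) ` F)"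
  unfolding triple_suitable_def
proof (intro conjI ballI impI)
  show "finite ((\<lambda>\<sigma>. \<sigma> \<circ> g) ` F)"
    using F by (simp add: triple_suitable_def)
  show "inj_on \<tau> A" if "\<tau> \<in> (\<lambda>\<sigma>. \<sigma> \<circ> g) ` F" for \<tau>
    using that F g by (auto simp: triple_suitable_def intro!: comp_inj_on intro: inj_on_subset)
  fix a b c assume "a \<in> A" "b \<in> A" "c \<in> A" "a \<noteq> b" "a \<noteq> c"
  then have "g a \<in> B" "g b \<in> B" "g c \<in> B" "g a \<noteq> g b" "g a \<noteq> g c"
    using g by (auto dest: inj_onD)
  from triple_suitableD[OF F this]
  show "\<exists>\<tau>\<in>(\<lambda>\<sigma>. \<sigma> \<circ> g) ` F. \<tau> a < \<tau> b \<and> \<tau> a < \<tau> c" by force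
qed

text \<open>Passing to the rank turns the lexicographic order of pairs back into an integer key, so
  that the product can be iterated.\<close>

definition lex_order :: "'a set \<Rightarrow> ('a \<Rightarrow> int) \<Rightarrow> ('a \<Rightarrow> int) \<Rightarrow> 'a \<times> 'a \<Rightarrow> int" where
  "lex_order A \<sigma> \<tau> = (\<lambda>x. int (rank (A \<times> A) (\<lambda>(u, v). (\<sigma> u, \<tau> v)) x))"

lemma lex_order_less:
  assumes "finite A" "a \<in> A \<times> A" "b \<in> A \<times> A"
    and "\<sigma> (fst a) < \<sigma> (fst b) \<or> fst a = fst b \<and> \<tau> (snd a) < \<tau> (snd b)"
  shows "lex_order A \<sigma> \<tau> a < lex_order A \<sigma> \<tau> b"
  unfolding lex_order_def of_nat_less_iff
  using assms by (intro rank_less) (auto simp: less_prod_def split: prod.splits)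

lemma inj_on_lex_order:
  assumes "finite A" "inj_on \<sigma> A" "inj_on \<tau> A"
  shows "inj_on (lex_order A \<sigma> \<tau>) (A \<times> A)"
proof -
  have "inj_on (\<lambda>(u, v). (\<sigma> u, \<tau> v)) (A \<times> A)"
    using assms by (auto simp: inj_on_def)
  then have "inj_on (rank (A \<times> A) (\<lambda>(u, v). (\<sigma> u, \<tau> v))) (A \<times> A)"
    using assms by (intro inj_on_rank) auto
  then show ?thesis
    by (simp add: lex_order_def inj_on_def)
qed

text \<open>If the first coordinates of \<open>b\<close> and \<open>c\<close> both agree with that
  of \<open>a\<close>, or both differ from it, one coordinate decides both comparisons and
  \<open>F\<close> provides the order. Otherwise each coordinate decides one comparison, so one
  order suffices, with its direction chosen separately in each coordinate; this costs the four extra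
  products.\<close>

lemma triple_suitable_square:
  assumes fin: "finite A" and F: "triple_suitable A F" and \<tau>: "\<tau> \<in> F"
  defines "\<tau>' \<equiv> \<lambda>x. - \<tau> x"
  defines "G \<equiv> (\<lambda>\<sigma>. lex_order A \<sigma> \<sigma>) ` F \<union>
    {lex_order A \<tau> \<tau>, lex_order A \<tau> \<tau>', lex_order A \<tau>' \<tau>, lex_order A \<tau>' \<tau>'}"
  shows "triple_suitable (A \<times> A) G" and "card G \<le> card F + 4"
proof -
  have injF: "inj_on \<sigma> A" if "\<sigma> \<in> F" for \<sigma>
    using that F by (simp add: triple_suitable_def)
  have inj: "inj_on \<tau> A" "inj_on \<tau>' A"
    using injF[OF \<tau>] by (simp_all add: \<tau>'_def inj_on_def)
  have finF: "finite F"
    using F by (simp add: triple_suitable_def)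
  have split: "\<exists>\<rho>\<in>{\<tau>, \<tau>'}. \<rho> x < \<rho> y" if "x \<in> A" "y \<in> A" "x \<noteq> y" for x y
  proof -
    have "\<tau> x \<noteq> \<tau> y"
      using that inj(1) by (auto dest: inj_onD)
    then have "\<tau> x < \<tau> y \<or> \<tau>' x < \<tau>' y"
      by (auto simp: \<tau>'_def)
    then show ?thesis by blast
  qed
  have mixed: "\<exists>\<sigma>\<in>G. \<sigma> a < \<sigma> b \<and> \<sigma> a < \<sigma> c"
    if abc: "a \<in> A \<times> A" "b \<in> A \<times> A" "c \<in> A \<times> A" "a \<noteq> b" "fst a = fst b" "fst a \<noteq> fst c"
    for a b c
  proof -
    have "fst a \<in> A" "fst c \<in> A" "snd a \<in> A" "snd b \<in> A" "snd a \<noteq> snd b"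
      using abc by (auto simp: prod_eq_iff)
    \<comment> \<open>Here \<open>\<rho>1\<close> puts \<open>a\<close> before \<open>c\<close>, and
      \<open>\<rho>2\<close> breaks the tie between \<open>a\<close> and \<open>b\<close>.\<close>
    then obtain \<rho>1 \<rho>2 where \<rho>: "\<rho>1 \<in> {\<tau>, \<tau>'}" "\<rho>1 (fst a) < \<rho>1 (fst c)"
      "\<rho>2 \<in> {\<tau>, \<tau>'}" "\<rho>2 (snd a) < \<rho>2 (snd b)"
      using bexE[OF split[of "fst a" "fst c"]] bexE[OF split[of "snd a" "snd b"]] abc(6) by metis
    from \<rho>(1,3) have "lex_order A \<rho>1 \<rho>2 \<in> G"
      by (auto simp: G_def)
    moreover have "lex_order A \<rho>1 \<rho>2 a < lex_order A \<rho>1 \<rho>2 b" "lex_order A \<rho>1 \<rho>2 a < lex_order A \<rho>1 \<rho>2 c"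
      by (rule lex_order_less; use abc \<rho> fin in blast)+
    ultimately show ?thesis by blast
  qed
  show "triple_suitable (A \<times> A) G"
    unfolding triple_suitable_def
  proof (intro conjI ballI impI)
    show "finite G"
      using finF by (simp add: G_def)
    show "inj_on \<sigma> (A \<times> A)" if "\<sigma> \<in> G" for \<sigma>
      using that injF inj fin by (auto simp: G_def intro: inj_on_lex_order)
    fix a b c assume in_A: "a \<in> A \<times> A" "b \<in> A \<times> A" "c \<in> A \<times> A" and ne: "a \<noteq> b" "a \<noteq> c"
    have mem: "fst a \<in> A" "fst b \<in> A" "fst c \<in> A" "snd a \<in> A" "snd b \<in> A" "snd c \<in> A"
      using in_A by auto
    consider "fst a = fst b" "fst a = fst c" | "fst a = fst b" "fst a \<noteq> fst c"
      | "fst a \<noteq> fst b" "fst a = fst c" | "fst a \<noteq> fst b" "fst a \<noteq> fst c" by blast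
    then show "\<exists>\<sigma>\<in>G. \<sigma> a < \<sigma> b \<and> \<sigma> a < \<sigma> c"
    proof cases
      case 1
      then have "snd a \<noteq> snd b" "snd a \<noteq> snd c"
        using ne by (auto simp: prod_eq_iff)
      then obtain \<sigma> where \<sigma>: "\<sigma> \<in> F" "\<sigma> (snd a) < \<sigma> (snd b)" "\<sigma> (snd a) < \<sigma> (snd c)"
        using triple_suitableD[OF F mem(4-6)] by blast
      have "lex_order A \<sigma> \<sigma> a < lex_order A \<sigma> \<sigma> b" "lex_order A \<sigma> \<sigma> a < lex_order A \<sigma> \<sigma> c"
        by (rule lex_order_less; use 1 in_A \<sigma> fin in blast)+
      then show ?thesis
        using \<sigma>(1) unfolding G_def by blast
    next
      case 2
      then show ?thesis using mixed[OF in_A ne(1)] by blast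
    next
      case 3
      then show ?thesis using mixed[OF in_A(1,3,2) ne(2)] by blast
    next
      case 4
      then obtain \<sigma> where \<sigma>: "\<sigma> \<in> F" "\<sigma> (fst a) < \<sigma> (fst b)" "\<sigma> (fst a) < \<sigma> (fst c)"
        using triple_suitableD[OF F mem(1-3)] by blast
      have "lex_order A \<sigma> \<sigma> a < lex_order A \<sigma> \<sigma> b" "lex_order A \<sigma> \<sigma> a < lex_order A \<sigma> \<sigma> c"
        by (rule lex_order_less; use in_A \<sigma> fin in blast)+
      then show ?thesis
        using \<sigma>(1) unfolding G_def by blast
    qed
  qed
  have "card G \<le> card ((\<lambda>\<sigma>. lex_order A \<sigma> \<sigma>) ` F)
      + card {lex_order A \<tau> \<tau>, lex_order A \<tau> \<tau>', lex_order A \<tau>' \<tau>, lex_order A \<tau>' \<tau>'}"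
    unfolding G_def by (rule card_Un_le)
  also have "\<dots> \<le> card F + 4"
    by (rule add_mono[OF card_image_le[OF finF]]) (simp add: card_insert_if)
  finally show "card G \<le> card F + 4" .
qed

text \<open>Two points need one order and its reverse; each squaring of the ground set adds four
  orders. Nonemptiness is carried along because squaring picks an order from the family.\<close>

lemma ex_triple_suitable_lessThan:
  "\<exists>F. triple_suitable {..<(2::nat) ^ 2 ^ s} F \<and> F \<noteq> {} \<and> card F \<le> 4 * s + 2"
proof (induction s)
  case 0
  have "triple_suitable {..<2::nat} {int, \<lambda>x. - int x}"
    by (auto simp: triple_suitable_def inj_on_def)
  moreover have "card {int, \<lambda>x. - int x} \<le> 2"
    by (simp add: card_insert_if)
  ultimately show ?case by (intro exI[of _ "{int, \<lambda>x. - int x}"]) simp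
next
  case (Suc s)
  define N where "N = (2::nat) ^ 2 ^ s"
  obtain F where F: "triple_suitable {..<N} F" "F \<noteq> {}" "card F \<le> 4 * s + 2"
    using Suc by (auto simp: N_def)
  obtain G where G: "triple_suitable ({..<N} \<times> {..<N}) G" "card G \<le> card F + 4" "G \<noteq> {}"
  proof -
    obtain \<tau> where "\<tau> \<in> F" using F(2) by blast
    from triple_suitable_square[OF finite_lessThan F(1) this] show ?thesis
      by (rule that) simp
  qed
  \<comment> \<open>The two digits in base \<open>N\<close> embed the numbers below
    \<open>N * N\<close> into the square.\<close>
  define g where "g = (\<lambda>x. (x div N, x mod N))"
  have N2: "2 ^ 2 ^ Suc s = N * N"
    by (simp add: N_def power_add[symmetric] mult_2)
  have "inj g"
    by (rule injI) (metis Pair_inject div_mult_mod_eq g_def)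
  then have "inj_on g {..<N * N}"
    by (rule inj_on_subset) simp
  moreover have "g ` {..<N * N} \<subseteq> {..<N} \<times> {..<N}"
    by (auto simp: g_def N_def less_mult_imp_div_less)
  ultimately have "triple_suitable {..<N * N} ((\<lambda>\<sigma>. \<sigma> \<circ> g) ` G)"
    by (rule triple_suitable_comp[OF G(1)])
  moreover have "card ((\<lambda>\<sigma>. \<sigma> \<circ> g) ` G) \<le> card G"
    using G(1) by (intro card_image_le) (simp add: triple_suitable_def)
  ultimately show ?case
    using G F(3) unfolding N2 by (intro exI[of _ "(\<lambda>\<sigma>. \<sigma> \<circ> g) ` G"]) auto
qed

lemma ex_triple_suitable:
  assumes "finite V" "card V \<le> 2 ^ 2 ^ s"
  shows "\<exists>F. triple_suitable V F \<and> card F \<le> 4 * s + 2"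
proof -
  obtain F where F: "triple_suitable {..<(2::nat) ^ 2 ^ s} F" "card F \<le> 4 * s + 2"
    using ex_triple_suitable_lessThan by blast
  obtain g where "bij_betw g V {0..<card V}"
    using ex_bij_betw_finite_nat[OF assms(1)] by blast
  then have "inj_on g V" "g ` V \<subseteq> {..<2 ^ 2 ^ s}"
    using assms(2) by (auto simp: bij_betw_def)
  then have "triple_suitable V ((\<lambda>\<sigma>. \<sigma> \<circ> g) ` F)"
    by (rule triple_suitable_comp[OF F(1)])
  moreover have "card ((\<lambda>\<sigma>. \<sigma> \<circ> g) ` F) \<le> card F"
    using F(1) by (intro card_image_le) (simp add: triple_suitable_def)
  ultimately show ?thesis
    using F(2) le_trans by blast
qed

subsection \<open>Star forests\<close>

text \<open>
  A star forest is given by the idempotent map \<open>c\<close> sending each vertex to the centre of its star.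
\<close>
definition star_key :: "('a \<Rightarrow> 'a) \<Rightarrow> int \<Rightarrow> ('a \<Rightarrow> int) \<Rightarrow> 'a \<Rightarrow> int \<times> bool \<times> int" where
  "star_key c s \<sigma> x = (s * \<sigma> (c x), c x \<noteq> x, \<sigma> x)"

lemma inj_on_star_key: "inj_on \<sigma> V \<Longrightarrow> inj_on (star_key c s \<sigma>) V"
  by (auto simp: star_key_def inj_on_def)

text \<open>The key sorts by block (in direction \<open>s\<close>), then puts the centre first since
  \<open>False < True\<close>, then sorts leaves by \<open>\<sigma>\<close>. The edge always comes
  before the pair; the cases are which of \<open>u\<close>, \<open>v\<close> share its block. If
  neither does, compare centres; if both do, they are leaves and are compared with
  \<open>l\<close>.\<close>

lemma star_forest_separates:
  assumes fin: "finite V" and F: "triple_suitable V F"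
    and c: "\<And>v. v \<in> V \<Longrightarrow> c v \<in> V" "\<And>v. v \<in> V \<Longrightarrow> c (c v) = c v"
    and l: "l \<in> V" "c l \<noteq> l" and uv: "u \<in> V" "v \<in> V" "{l, c l} \<inter> {u, v} = {}"
  shows "\<exists>s\<in>{1, -1}. \<exists>\<sigma>\<in>F. separates (rank V (star_key c s \<sigma>)) {l, c l} {u, v}"
proof -
  have rank: ?thesis
    if "s \<in> {1, -1}" "\<sigma> \<in> F" "star_key c s \<sigma> l < star_key c s \<sigma> u" "star_key c s \<sigma> l < star_key c s \<sigma> v"
      "star_key c s \<sigma> (c l) < star_key c s \<sigma> u" "star_key c s \<sigma> (c l) < star_key c s \<sigma> v" for s \<sigma>
    using that fin l uv c(1)
    by (intro bexI[of _ s] bexI[of _ \<sigma>]) (auto simp: separates_def precedes_def intro!: rank_less)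
  have mixed: ?thesis if xy: "x \<in> V" "y \<in> V" "{x, y} = {u, v}" "c x = c l" "c y \<noteq> c l" for x y
  proof -
    have x: "x \<noteq> l" "x \<noteq> c l"
      using that uv by auto
    \<comment> \<open>Only \<open>x\<close> shares the block of \<open>l\<close>, so the triple
      \<open>l\<close>, \<open>x\<close>, \<open>x\<close> suffices to fix the leaf order.\<close>
    then obtain \<sigma> where \<sigma>: "\<sigma> \<in> F" "\<sigma> l < \<sigma> x"
      using triple_suitableD[OF F l(1) xy(1) xy(1)] by blast
    have "\<sigma> (c l) \<noteq> \<sigma> (c y)"
      using \<sigma>(1) F xy c(1)[of y] c(1)[of l] l by (metis inj_onD triple_suitable_def)
    \<comment> \<open>As \<open>\<sigma>\<close> is already fixed, the blocks of \<open>l\<close>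
      and \<open>y\<close> may be in either order; the sign \<open>s\<close> corrects this.\<close>
    then obtain s :: int where "s \<in> {1, -1}" "s * \<sigma> (c l) < s * \<sigma> (c y)"
      using that[of 1] that[of "-1"] by (cases "\<sigma> (c l) < \<sigma> (c y)") auto
    moreover from this have "star_key c s \<sigma> w < star_key c s \<sigma> z" if "w \<in> {l, c l}" "z \<in> {x, y}" for w z
      using that \<sigma> x xy(4) c(2)[OF l(1)] l(2) by (auto simp: star_key_def)
    ultimately show ?thesis
      using \<sigma>(1) xy(3) by (intro rank[of s \<sigma>]) auto
  qed
  consider "c u \<noteq> c l" "c v \<noteq> c l" | "c u = c l" "c v \<noteq> c l" | "c u \<noteq> c l" "c v = c l"
    | "c u = c l" "c v = c l" by blast
  then show ?thesis
  proof cases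
    case 1
    then obtain \<sigma> where "\<sigma> \<in> F" "\<sigma> (c l) < \<sigma> (c u)" "\<sigma> (c l) < \<sigma> (c v)"
      using triple_suitableD[OF F c(1) c(1) c(1), of l u v] l(1) uv(1,2) by auto
    then show ?thesis
      using c(2) l by (intro rank[of 1 \<sigma>]) (auto simp: star_key_def less_prod_def)
  next
    case 2
    then show ?thesis using mixed uv by blast
  next
    case 3
    then show ?thesis using mixed[of v u] uv by blast
  next
    case 4
    have "l \<noteq> u" "l \<noteq> v" using uv by auto
    then obtain \<sigma> where "\<sigma> \<in> F" "\<sigma> l < \<sigma> u" "\<sigma> l < \<sigma> v"
      using triple_suitableD[OF F l(1) uv(1,2)] by blast
    then show ?thesis
      using 4 c(2) l uv by (intro rank[of 1 \<sigma>]) (auto simp: star_key_def less_prod_def)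
  qed
qed

text \<open>The colour is the parity of the number of steps of \<open>f\<close> needed to reach a
  fixed point.\<close>

lemma ex_colouring_functional_forest:
  fixes h :: "'a \<Rightarrow> nat"
  assumes "finite V" and f: "\<And>v. v \<in> V \<Longrightarrow> f v = v \<or> f v \<in> V \<and> h v < h (f v)"
  shows "\<exists>\<chi>::'a \<Rightarrow> bool. \<forall>v\<in>V. f v \<noteq> v \<longrightarrow> \<chi> (f v) \<noteq> \<chi> v"
proof -
  define P where "P v m \<longleftrightarrow> f ((f ^^ m) v) = (f ^^ m) v" for v m
  have ex: "\<exists>m. P v m" if v: "v \<in> V" for v
  proof (rule ccontr)
    assume no: "\<nexists>m. P v m"
    \<comment> \<open>Without a fixed point \<open>h\<close> grows at every step, which contradicts
      its boundedness on \<open>V\<close>.\<close>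
    have "(f ^^ m) v \<in> V \<and> m \<le> h ((f ^^ m) v)" for m
    proof (induction m)
      case (Suc m)
      then show ?case using f[of "(f ^^ m) v"] no by (force simp: P_def)
    qed (use v in simp)
    then have "m \<le> Max (h ` V)" for m
      using assms(1) by (meson Max_ge finite_imageI imageI order_trans)
    then show False
      using not_less_eq_eq by blast
  qed
  have "(LEAST m. P v m) = Suc (LEAST m. P (f v) m)" if v: "v \<in> V" "f v \<noteq> v" for v
  proof -
    obtain m where "P v m" using ex v(1) by blast
    \<comment> \<open>\<open>P v 0\<close> fails because \<open>v\<close> is not fixed, so the depth
      drops by exactly one from \<open>v\<close> to \<open>f v\<close>.\<close>
    then have "(LEAST m. P v m) = Suc (LEAST m. P v (Suc m))"
      using v(2) by (intro Least_Suc) (auto simp: P_def)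
    then show ?thesis by (simp add: P_def funpow_swap1)
  qed
  then show ?thesis
    by (intro exI[of _ "\<lambda>v. even (LEAST m. P v m)"]) auto
qed

section \<open>Separation dimension of degenerate graphs\<close>

lemma separation_dimension_le_card:
  assumes "pairwise_suitable V E F"
  shows "separation_dimension V E \<le> card F"
  unfolding separation_dimension_def using assms by (intro Least_le) blast

text \<open>The arrows from each vertex to its \<open>i\<close>-th later neighbour form a functional
  forest, and keeping only the arrows that start in one colour class leaves stars. Every edge is an
  arrow from its earlier end.\<close>

lemma degenerate_star_forests:
  assumes G: "simple_graph V E" and deg: "degenerate k V E"
  obtains c :: "nat \<Rightarrow> bool \<Rightarrow> 'a \<Rightarrow> 'a" where
    "\<And>i p v. v \<in> V \<Longrightarrow> c i p v \<in> V" "\<And>i p v. v \<in> V \<Longrightarrow> c i p (c i p v) = c i p v"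
    "\<And>e. e \<in> E \<Longrightarrow> \<exists>i<k. \<exists>p. \<exists>l\<in>V. c i p l \<noteq> l \<and> e = {l, c i p l}"
proof -
  have fin: "finite V"
    using G by (simp add: simple_graph_def)
  obtain h where h: "h \<in> permutations_of V"
    "\<And>v. v \<in> V \<Longrightarrow> card {w \<in> V. {v, w} \<in> E \<and> h v < h w} \<le> k"
    using deg by (auto simp: degenerate_def)
  define N where "N v = {w \<in> V. {v, w} \<in> E \<and> h v < h w}" for v
  have finN: "finite (N v)" for v
    using fin by (simp add: N_def)
  obtain g where g: "\<And>v. bij_betw (g v) {0..<card (N v)} (N v)"
    using ex_bij_betw_nat_finite[OF finN] by metis
  \<comment> \<open>A vertex with at most \<open>i\<close> later neighbours is a root, encoded as a
    fixed point.\<close>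
  define f where "f i v = (if i < card (N v) then g v i else v)" for i v
  have f: "f i v = v \<or> f i v \<in> N v" for i v
    using bij_betwE[OF g[of v]] by (auto simp: f_def)
  have "\<exists>\<chi>::'a \<Rightarrow> bool. \<forall>v\<in>V. f i v \<noteq> v \<longrightarrow> \<chi> (f i v) \<noteq> \<chi> v" for i
    using f by (intro ex_colouring_functional_forest[of V "f i" h] fin) (force simp: N_def)
  then obtain \<chi> :: "nat \<Rightarrow> 'a \<Rightarrow> bool"
    where \<chi>: "\<And>i v. v \<in> V \<Longrightarrow> f i v \<noteq> v \<Longrightarrow> \<chi> i (f i v) \<noteq> \<chi> i v"
    by metis
  \<comment> \<open>Colours change along arrows, so the target of a kept arrow has no kept arrow
    itself; hence \<open>c i p\<close> is idempotent.\<close>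
  define c where "c i p v = (if \<chi> i v = p then f i v else v)" for i p v
  have edge: "\<exists>i<k. \<exists>p. c i p a \<noteq> a \<and> c i p a = b" if ab: "a \<in> V" "b \<in> N a" for a b
  proof -
    obtain i where "i < card (N a)" "g a i = b"
      using bij_betw_imp_surj_on[OF g[of a]] ab(2) by (metis atLeastLessThan_iff imageE)
    moreover have "card (N a) \<le> k" "a \<noteq> b"
      using h(2) ab by (auto simp: N_def)
    ultimately show ?thesis
      by (intro exI[of _ i] conjI exI[of _ "\<chi> i a"]) (auto simp: c_def f_def)
  qed
  show thesis
  proof (rule that)
    show "c i p v \<in> V" if "v \<in> V" for i p v
      using that f[of i v] by (auto simp: c_def N_def)
    show "c i p (c i p v) = c i p v" if "v \<in> V" for i p v
      using \<chi>[OF that, of i] by (cases "f i v = v") (auto simp: c_def)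
    fix e assume e: "e \<in> E"
    then obtain a b where ab: "e = {a, b}" "a \<noteq> b" "a \<in> V" "b \<in> V"
      using G by (auto simp: simple_graph_def card_2_iff)
    have "h a \<noteq> h b"
      using h(1) ab by (auto simp: permutations_of_def bij_betw_def dest: inj_onD)
    then have "b \<in> N a \<or> a \<in> N b"
      using ab e by (auto simp: N_def insert_commute)
    then show "\<exists>i<k. \<exists>p. \<exists>l\<in>V. c i p l \<noteq> l \<and> e = {l, c i p l}"
      using edge ab by (metis insert_commute)
  qed
qed

lemma separation_dimension_le_triple_suitable:
  assumes G: "simple_graph V E" and deg: "degenerate k V E" and F: "triple_suitable V F"
  shows "separation_dimension V E \<le> 4 * k * card F"
proof -
  have fin: "finite V" and finF: "finite F"
    using G F by (simp_all add: simple_graph_def triple_suitable_def)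
  obtain c :: "nat \<Rightarrow> bool \<Rightarrow> 'a \<Rightarrow> 'a" where
    c: "\<And>i p v. v \<in> V \<Longrightarrow> c i p v \<in> V" "\<And>i p v. v \<in> V \<Longrightarrow> c i p (c i p v) = c i p v"
      "\<And>e. e \<in> E \<Longrightarrow> \<exists>i<k. \<exists>p. \<exists>l\<in>V. c i p l \<noteq> l \<and> e = {l, c i p l}"
    using degenerate_star_forests[OF G deg] by blast
  \<comment> \<open>The factor 4 in the bound comes from two colours \<open>p\<close> and two block
    directions \<open>s\<close>.\<close>
  define I where "I = {..<k} \<times> (UNIV :: bool set) \<times> {1, -1 :: int} \<times> F"
  define R where "R = (\<lambda>(i, p, s, \<sigma>). rank V (star_key (c i p) s \<sigma>)) ` I"
  have "pairwise_suitable V E R"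
    unfolding pairwise_suitable_def
  proof (intro conjI ballI impI)
    show "R \<subseteq> permutations_of V"
      using F fin by (auto simp: R_def I_def triple_suitable_def intro!: rank_in_permutations_of inj_on_star_key)
    fix e f assume ef: "e \<in> E" "f \<in> E" "e \<inter> f = {}"
    obtain i p l where l: "i < k" "l \<in> V" "c i p l \<noteq> l" "e = {l, c i p l}"
      using c(3)[OF ef(1)] by blast
    obtain u v where uv: "f = {u, v}" "u \<in> V" "v \<in> V"
      using ef(2) G by (auto simp: simple_graph_def card_2_iff)
    obtain s \<sigma> where "s \<in> {1, -1}" "\<sigma> \<in> F" "separates (rank V (star_key (c i p) s \<sigma>)) e f"
      using star_forest_separates[OF fin F c(1,2) l(2,3) uv(2,3)] ef(3) l(4) uv(1) by blast
    moreover from this have "rank V (star_key (c i p) s \<sigma>) \<in> R"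
      using l(1) by (force simp: R_def I_def)
    ultimately show "\<exists>\<sigma>\<in>R. separates \<sigma> e f" by blast
  qed
  then have "separation_dimension V E \<le> card R"
    by (rule separation_dimension_le_card)
  also have "\<dots> \<le> card I"
    unfolding R_def using finF by (intro card_image_le) (simp add: I_def)
  also have "\<dots> = 4 * k * card F"
    by (simp add: I_def card_cartesian_product)
  finally show ?thesis .
qed

section \<open>The bound in terms of log log n\<close>

text \<open>Keeps log log n away from 0, so that additive constants can be absorbed into a multiple
  of it. The numbers rest on \<open>sqrt 8 \<le> 3\<close> and
  \<open>sqrt 2 \<le> 3 / 2\<close>.\<close>

lemma half_le_log_log:
  assumes "3 \<le> n"
  shows "1 / 2 \<le> log 2 (log 2 (real n))"
proof -
  have "2 powr (3 / 2) = (2 powr 3) powr (1 / 2 :: real)"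
    by (simp only: powr_powr) simp
  also have "\<dots> = sqrt (2 powr 3)"
    by (simp add: powr_half_sqrt)
  also have "\<dots> = sqrt 8"
    by simp
  also have "\<dots> \<le> 3"
    by (rule real_le_lsqrt) auto
  finally have "3 / 2 \<le> log 2 (real n)"
    using assms by (subst le_log_iff) auto
  moreover have "sqrt 2 \<le> 3 / 2"
    by (rule real_le_lsqrt) (auto simp: power2_eq_square)
  ultimately have "2 powr (1 / 2) \<le> log 2 (real n)"
    by (simp add: powr_half_sqrt)
  then show ?thesis
    by (subst le_log_iff) (auto intro: less_le_trans[of _ "2 powr (1/2)"])
qed

theorem theorem1:
  shows "\<exists>c::real. c > 0 \<and>
    (\<forall>(k::nat) (n::nat) (V::'a set) (E::'a set set).
       k \<ge> 1 \<longrightarrow> n \<ge> 3 \<longrightarrow> simple_graph V E \<longrightarrow> card V = n \<longrightarrow> degenerate k V E \<longrightarrow>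
       real (separation_dimension V E) \<le> c * real k * log 2 (log 2 (real n)))"
proof (intro exI[of _ 64] conjI allI impI)
  fix k n :: nat and V :: "'a set" and E :: "'a set set"
  assume n: "3 \<le> n" and G: "simple_graph V E" "card V = n" "degenerate k V E"
  define L where "L = log 2 (log 2 (real n))"
  \<comment> \<open>Rounding up makes \<open>2 ^ 2 ^ s\<close> at least \<open>n\<close>, while
    \<open>s\<close> exceeds \<open>L\<close> by at most 1.\<close>
  define s where "s = nat \<lceil>L\<rceil>"
  have L: "1 / 2 \<le> L"
    using half_le_log_log[OF n] by (simp add: L_def)
  then have s: "L \<le> real s" "real s \<le> L + 1"
    by (auto simp: s_def)
  have "0 < log 2 (real n)"
    using n by simp
  then have "log 2 (real n) \<le> 2 powr real s"
    using s(1) by (simp add: L_def log_le_iff)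
  then have "log 2 (real n) \<le> real (2 ^ s)"
    by (simp add: powr_realpow)
  then have "real n \<le> 2 powr real (2 ^ s)"
    using n by (simp add: log_le_iff del: of_nat_power)
  then have "real n \<le> real (2 ^ 2 ^ s)"
    by (simp add: powr_realpow del: of_nat_power)
  then have "card V \<le> 2 ^ 2 ^ s"
    using G(2) by (simp only: of_nat_le_iff)
  then obtain F where F: "triple_suitable V F" "card F \<le> 4 * s + 2"
    using ex_triple_suitable G(1) by (metis simple_graph_def)
  have "real (separation_dimension V E) \<le> 4 * real k * real (card F)"
    using separation_dimension_le_triple_suitable[OF G(1,3) F(1)]
    by (metis of_nat_le_iff of_nat_mult of_nat_numeral)
  \<comment> \<open>\<open>4 * s + 2 \<le> 4 * L + 6 \<le> 16 * L\<close>, since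
    \<open>L \<ge> 1 / 2\<close>; this gives the constant 64.\<close>
  also have "\<dots> \<le> 4 * real k * (16 * L)"
    using F(2) s(2) L by (intro mult_left_mono) auto
  finally show "real (separation_dimension V E) \<le> 64 * real k * log 2 (log 2 (real n))"
    by (simp add: L_def)
qed simp

end
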